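(* Let $R$ be an elementary divisor domain, let $g(t)\in R[t]$ be monic of degree $n$, and let $f(t)\in R[t]$. Let $z(t)$ be the monic greatest common divisor of $f(t)$ and $g(t)$ in $R[t]$, and write $f(t)=z(t)F(t)$, $g(t)=z(t)G(t)$ with $F(t),G(t)\in R[t]$. Then the last non-zero determinantal divisor of $f(C_g)$ is, up to units of $R$, $$\gamma_r=\prod_{\theta:\,G(\theta)=0}F(\theta)=\mathrm{Res}(F,G).$$
   Context: An elementary divisor domain (EDD) is an integral domain $R$ such that for any $a,b,c\in R$ there exist $x,y,z,w\in R$ with $(a,b,c)=zxa+zyb+wyc$, where $(a,b,c)$ denotes the greatest common divisor; equivalently, an integral domain over which every matrix is equivalent (via unimodular matrices) to a diagonal matrix whose diagonal entries form a divisor chain. If $R$ is an EDD then $R$ and $R[t]$ are GCD domains. For a monic polynomial $g(t)=t^n+\sum_{k=0}^{n-1}g_kt^k\in R[t]$, the companion matrix $C_g\in R^{n\times n}$ has first row $(-g_{n-1},\dots,-g_1,-g_0)$, entries $1$ in positions $(i+1,i)$ for $1\le i\le n-1$, and $0$ elsewhere. For $f(t)=\sum_k f_kt^k$, $f(C_g)=\sum_k f_kC_g^k$. The $i$-th determinantal divisor $\gamma_i$ of a matrix $M$ over $R$ is the greatest common divisor of all minors of $M$ of order $i$, with $\gamma_0=1$; the last non-zero one is $\gamma_r$ where $r=\mathrm{rank}\,M$. The product over $\theta$ with $G(\theta)=0$ runs over the roots of the monic polynomial $G$ in an algebraic closure of the field of fractions of $R$, counted with multiplicity (an empty product is $1$);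 this product is the definition of $\mathrm{Res}(F,G)$, with this normalization. *)

theory Defs
  imports
    "HOL-Computational_Algebra.Computational_Algebra"
    "HOL-Algebra.Algebraic_Closure_Type"
    "Jordan_Normal_Form.DL_Rank"
    "Jordan_Normal_Form.DL_Submatrix"
begin

text \<open>
  The rings at hand carry no chosen greatest common divisor, so \<open>is_gcd_of S d\<close> is a
  predicate, which determines \<open>d\<close> up to units only. A gcd of the empty set is \<open>0\<close>.
\<close>

definition (in comm_semiring_1) is_gcd_of :: "'a set \<Rightarrow> 'a \<Rightarrow> bool" where
  "is_gcd_of S d \<longleftrightarrow> (\<forall>s\<in>S. d dvd s) \<and> (\<forall>e. (\<forall>s\<in>S. e dvd s) \<longrightarrow> e dvd d)"

class elementary_divisor_domain = idom +
  assumes elementary_divisor: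
    "\<exists>d x y z w. is_gcd_of {a, b, c} d \<and> d = z * x * a + z * y * b + w * y * c"

definition companion_mat :: "'a::comm_ring_1 poly \<Rightarrow> 'a mat" where
  "companion_mat g = mat (degree g) (degree g)
     (\<lambda>(i, j). if i = 0 then - coeff g (degree g - 1 - j) else if i = j + 1 then 1 else 0)"

definition poly_mat :: "'a::comm_ring_1 poly \<Rightarrow> 'a mat \<Rightarrow> 'a mat" where
  "poly_mat f A = finsum (ring_mat TYPE('a) (dim_row A) ())
     (\<lambda>k. coeff f k \<cdot>\<^sub>m (A ^\<^sub>m k)) {..degree f}"

definition minors :: "'a::comm_ring_1 mat \<Rightarrow> nat \<Rightarrow> 'a set" where
  "minors M i = {det (submatrix M I J) | I J.
     I \<subseteq> {..<dim_row M} \<and> J \<subseteq> {..<dim_col M} \<and> card I = i \<and> card J = i}"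

text \<open>
  For \<open>i = 0\<close> the only minor is the empty determinant \<open>1\<close>, which gives the usual
  normalization \<open>\<gamma>\<^sub>0 = 1\<close> up to units. For \<open>i\<close> exceeding a dimension of
  the matrix there are no minors, and the divisor is \<open>0\<close>.
\<close>

definition is_det_divisor :: "'a::comm_ring_1 mat \<Rightarrow> nat \<Rightarrow> 'a \<Rightarrow> bool" where
  "is_det_divisor M i \<gamma> \<longleftrightarrow> is_gcd_of (minors M i) \<gamma>"

definition is_last_nonzero_det_divisor :: "'a::comm_ring_1 mat \<Rightarrow> nat \<Rightarrow> 'a \<Rightarrow> bool" where
  "is_last_nonzero_det_divisor M r \<gamma> \<longleftrightarrow>
     is_det_divisor M r \<gamma> \<and> \<gamma> \<noteq> 0 \<and> (\<forall>i>r. is_det_divisor M i 0)"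

text \<open>The rank of a matrix over a domain is its rank over the field of fractions.\<close>

definition fract_rank :: "'a::idom mat \<Rightarrow> nat" where
  "fract_rank M = vec_space.rank (dim_row M) (map_mat to_fract M)"

definition to_fract_closure :: "'a::idom \<Rightarrow> 'a fract alg_closure" where
  "to_fract_closure x = to_ac (to_fract x)"

text \<open>
  The resultant as a product over the roots of the monic second argument, counted with
  multiplicity. It may differ by a sign from the determinant of the Sylvester
  matrix of \<open>F\<close> and \<open>G\<close>. It takes values in the algebraic closure of the field of fractions.
\<close>

definition root_resultant :: "'a::idom poly \<Rightarrow> 'a poly \<Rightarrow> 'a fract alg_closure" where
  "root_resultant F G =
     (\<Prod>\<theta>\<in>#proots (map_poly to_fract_closure G). poly (map_poly to_fract_closure F) \<theta>)"

end

theory Submission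
  imports Defs "Jordan_Normal_Form.Char_Poly" "Jordan_Normal_Form.DL_Rank_Submatrix"
begin

text \<open>
  In the basis \<open>t\<^sup>n\<^sup>-\<^sup>1, \<dots>, t, 1\<close> of \<open>R[t]/(g)\<close>, with polynomials written as row vectors,
  right multiplication by \<open>f(C\<^sub>g)\<close> is multiplication by \<open>f\<close>. For \<open>f = z F\<close> and \<open>g = z G\<close>,
  \<open>k = deg G\<close>, this map factors as
  \<open>R[t]/(g) \<rightarrow> R[t]/(G) \<rightarrow> R[t]/(G) \<rightarrow> R[t]/(g)\<close>: reduce modulo \<open>G\<close>, multiply by \<open>F\<close>, multiply
  by \<open>z\<close>. In matrices, \<open>f(C\<^sub>g) = A F(C\<^sub>G) B\<close> with \<open>A\<close> of size \<open>n \<times> k\<close> and \<open>B\<close> of size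
  \<open>k \<times> n\<close> (\<open>poly_mat_companion_factor\<close>). Put \<open>\<rho> = det F(C\<^sub>G)\<close>. Every minor of order \<open>k\<close> is then
  a multiple of \<open>\<rho>\<close>. Polynomials of degree less than \<open>k\<close> are fixed by reduction modulo \<open>G\<close>,
  so \<open>A\<close> contains the identity matrix of order \<open>k\<close>; as \<open>z\<close> is monic, \<open>B\<close> contains
  a unitriangular block of order \<open>k\<close>. Hence \<open>\<rho>\<close> itself is a minor, and it is a greatest common
  divisor of all minors of order \<open>k\<close> (\<open>minors_poly_mat_companion\<close>). The factorization bounds
  the rank by \<open>k\<close>, so minors of larger order vanish. Two facts about \<open>\<rho>\<close> remain.

  First, \<open>\<rho>\<close> is the product of the values of \<open>F\<close> at the roots of \<open>G\<close>
  (\<open>root_resultant_eq_det\<close>). If \<open>G\<close> is a product of two monic polynomials, multiplication by \<open>F\<close>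
  on \<open>R[t]/(G)\<close> is block triangular in a suitable basis, so the determinant is multiplicative
  in \<open>G\<close> (\<open>det_poly_mat_companion_mult\<close>). Over the algebraic closure this reduces the claim
  to linear \<open>G\<close>, where it is evaluation at the root.

  Second, \<open>\<rho> \<noteq> 0\<close> (\<open>det_poly_mat_companion_nonzero\<close>). Otherwise there is \<open>p \<noteq> 0\<close> of degree
  less than \<open>k\<close> such that \<open>G\<close> divides \<open>F p\<close>. An elementary divisor domain is a Bezout domain, so
  polynomials over it have contents and satisfy a Gauss lemma. With these, a \<open>p\<close> of
  minimal degree gives a factorization \<open>G = q t\<close> over \<open>R\<close> itself such that \<open>deg q < k\<close> and \<open>t\<close>
  also divides \<open>F\<close>. Then \<open>z t\<close> is a common divisor of \<open>f\<close> and \<open>g\<close>, although \<open>z\<close> is a greatest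
  one and \<open>t\<close> is not constant.
\<close>

section \<open>Functions of a companion matrix\<close>

text \<open>
  The zero polynomial satisfies \<open>degree_lt 0\<close>, whereas \<open>degree 0 < 0\<close> fails. Thus
  \<open>degree_lt n\<close> describes the representatives of \<open>R[t]/(g)\<close> also for \<open>deg g = 0\<close>.
\<close>

abbreviation degree_lt :: "nat \<Rightarrow> 'a::zero poly \<Rightarrow> bool" where
  "degree_lt n p \<equiv> \<forall>i\<ge>n. coeff p i = 0"

text \<open>
  For a monic divisor, pseudo-division scales the dividend by a power of \<open>1\<close>,
  so \<open>pseudo_mod\<close> is an honest remainder over any integral domain.
\<close>

lemma degree_lt_pseudo_mod:
  fixes g :: "'a::idom poly"
  assumes "g \<noteq> 0"
  shows "degree_lt (degree g) (pseudo_mod p g)"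
  using pseudo_mod(2)[OF assms, of p] by (auto simp: coeff_eq_0)

lemma monic_dvd_diff_pseudo_mod:
  fixes g :: "'a::idom poly"
  assumes "lead_coeff g = 1"
  shows "g dvd p - pseudo_mod p g"
proof -
  obtain q r where qr: "pseudo_divmod p g = (q, r)" by fastforce
  have "g \<noteq> 0" using assms by auto
  from pseudo_divmod(1)[OF this qr] assms have "p = g * q + r" by simp
  moreover have "pseudo_mod p g = r" by (simp add: pseudo_mod_def qr)
  ultimately have "p = g * q + pseudo_mod p g" by (simp only:)
  then show ?thesis by (metis add_diff_cancel_right' dvd_triv_left)
qed

lemma dvd_degree_lt_imp_0:
  fixes g :: "'a::idom poly"
  assumes "g dvd r" "degree_lt (degree g) r"
  shows "r = 0"
proof (rule ccontr)
  assume r: "r \<noteq> 0"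
  with assms(1) have "degree g \<le> degree r" by (rule dvd_imp_degree_le)
  with assms(2) have "lead_coeff r = 0" by blast
  with r show False by simp
qed

lemma degree_less_if_degree_lt: "p \<noteq> 0 \<Longrightarrow> degree_lt n p \<Longrightarrow> degree p < n"
  by (metis leading_coeff_0_iff not_le_imp_less)

lemma degree_lt_mult:
  assumes "degree_lt k p"
  shows "degree_lt (degree z + k) (z * p)"
proof (cases "p = 0")
  case False
  have "degree (z * p) \<le> degree z + degree p" by (rule degree_mult_le)
  with degree_less_if_degree_lt[OF False assms] show ?thesis by (auto intro: coeff_eq_0)
qed simp

lemma coeff_monic_shift:
  fixes z :: "'a::comm_ring_1 poly"
  assumes z: "lead_coeff z = 1" and n: "n = degree z + k" and ij: "j \<le> i" "i < k"
  shows "coeff (z * monom 1 (k - 1 - i)) (n - 1 - j) = (if i = j then 1 else 0)"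
proof -
  have "coeff (z * monom 1 (k - 1 - i)) (n - 1 - j) = coeff z (n - 1 - j - (k - 1 - i))"
    using ij n by (simp add: mult.commute[of z] coeff_monom_mult)
  also have "n - 1 - j - (k - 1 - i) = degree z + (i - j)" using ij n by auto
  also have "coeff z (degree z + (i - j)) = (if i = j then 1 else 0)"
    using ij z by (auto intro: coeff_eq_0)
  finally show ?thesis .
qed

text \<open>
  Leading coefficients come first, since the first row of the companion matrix carries
  the coefficients of \<open>g\<close> in descending order.
\<close>

definition row_mat :: "nat \<Rightarrow> nat \<Rightarrow> (nat \<Rightarrow> 'a::zero poly) \<Rightarrow> 'a mat" where
  "row_mat k n P = mat k n (\<lambda>(i, j). coeff (P i) (n - 1 - j))"

lemma row_mat_carrier [simp]: "row_mat k n P \<in> carrier_mat k n"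
  and dim_row_row_mat [simp]: "dim_row (row_mat k n P) = k"
  and dim_col_row_mat [simp]: "dim_col (row_mat k n P) = n"
  and row_mat_index [simp]: "i < k \<Longrightarrow> j < n \<Longrightarrow> row_mat k n P $$ (i, j) = coeff (P i) (n - 1 - j)"
  by (simp_all add: row_mat_def)

lemma row_mat_cong:
  "(\<And>i. i < k \<Longrightarrow> P i = Q i) \<Longrightarrow> row_mat k n P = row_mat k n Q"
  by (auto simp: row_mat_def intro!: eq_matI)

lemma one_mat_eq_row_mat:
  "1\<^sub>m n = row_mat n n (\<lambda>i. monom 1 (n - 1 - i) :: 'a::comm_ring_1 poly)"
  by (rule eq_matI) (auto simp: coeff_monom)

text \<open>
  A product of such matrices expresses the substitution of the rows of the second one for the basis
  \<open>t\<^sup>k\<^sup>-\<^sup>1, \<dots>, 1\<close>.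
\<close>

lemma row_mat_mult_row_mat:
  fixes P Q :: "nat \<Rightarrow> 'a::comm_ring_1 poly"
  shows "row_mat a k P * row_mat k n Q
    = row_mat a n (\<lambda>i. \<Sum>l<k. smult (coeff (P i) l) (Q (k - 1 - l)))"
proof (rule eq_matI, goal_cases)
  case (1 i j)
  then have "(row_mat a k P * row_mat k n Q) $$ (i, j)
     = (\<Sum>l<k. coeff (P i) (k - 1 - l) * coeff (Q l) (n - 1 - j))"
    by (simp add: scalar_prod_def atLeast0LessThan)
  also have "\<dots> = (\<Sum>l<k. coeff (P i) l * coeff (Q (k - 1 - l)) (n - 1 - j))"
    by (rule sum.reindex_bij_witness[of _ "\<lambda>l. k - 1 - l" "\<lambda>l. k - 1 - l"]) auto
  finally show ?case using 1 by (simp add: coeff_sum)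
qed auto

lemma sum_smult_monom_eq:
  fixes p :: "'a::comm_ring_1 poly"
  assumes "degree_lt k p"
  shows "(\<Sum>l<k. smult (coeff p l) (h * monom 1 l)) = h * p"
proof -
  have "p = (\<Sum>l<k. monom (coeff p l) l)"
    by (rule poly_eqI) (use assms in \<open>auto simp: coeff_sum coeff_monom sum.delta'\<close>)
  then have "h * p = (\<Sum>l<k. h * monom (coeff p l) l)"
    by (metis sum_distrib_left)
  also have "\<dots> = (\<Sum>l<k. smult (coeff p l) (h * monom 1 l))"
    by (rule sum.cong) (auto simp: smult_monom simp flip: mult_smult_right)
  finally show ?thesis by simp
qed

lemma row_mat_mult_shifts:
  fixes P :: "nat \<Rightarrow> 'a::comm_ring_1 poly"
  assumes "\<And>i. i < a \<Longrightarrow> degree_lt k (P i)"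
  shows "row_mat a k P * row_mat k n (\<lambda>i. h * monom 1 (k - 1 - i)) = row_mat a n (\<lambda>i. h * P i)"
  unfolding row_mat_mult_row_mat
proof (rule row_mat_cong)
  fix i assume "i < a"
  have "(\<Sum>l<k. smult (coeff (P i) l) (h * monom 1 (k - 1 - (k - 1 - l))))
      = (\<Sum>l<k. smult (coeff (P i) l) (h * monom 1 l))"
    by (rule sum.cong) auto
  also have "\<dots> = h * P i"
    by (rule sum_smult_monom_eq) (use assms \<open>i < a\<close> in blast)
  finally show "(\<Sum>l<k. smult (coeff (P i) l) (h * monom 1 (k - 1 - (k - 1 - l)))) = h * P i" .
qed

lemma companion_mat_carrier [simp]: "companion_mat g \<in> carrier_mat (degree g) (degree g)"
  by (simp add: companion_mat_def)

text \<open>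
  The companion matrix multiplies each row by \<open>t\<close> and subtracts the multiple of \<open>g\<close> that
  cancels the coefficient of \<open>t\<^sup>n\<close>.
\<close>

lemma row_mat_mult_companion:
  fixes P :: "nat \<Rightarrow> 'a::comm_ring_1 poly"
  shows "row_mat k (degree g) P * companion_mat g
    = row_mat k (degree g) (\<lambda>i. pCons 0 (P i) - smult (coeff (P i) (degree g - 1)) g)"
proof (rule eq_matI, goal_cases)
  case (1 i j)
  let ?n = "degree g"
  from 1 have ij: "i < k" "j < ?n" by auto
  have "(row_mat k ?n P * companion_mat g) $$ (i, j)
     = (\<Sum>l<?n. coeff (P i) (?n - 1 - l) *
          (if l = 0 then - coeff g (?n - 1 - j) else if l = j + 1 then 1 else 0))"
    using ij by (simp add: scalar_prod_def companion_mat_def atLeast0LessThan)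
  also have "\<dots> = (\<Sum>l<?n. (if l = 0 then - (coeff (P i) (?n - 1) * coeff g (?n - 1 - j)) else 0)
                     + (if l = j + 1 then coeff (P i) (?n - 1 - l) else 0))"
    by (rule sum.cong) auto
  also have "\<dots> = (if j + 1 < ?n then coeff (P i) (?n - 1 - (j + 1)) else 0)
                    - coeff (P i) (?n - 1) * coeff g (?n - 1 - j)"
    using ij by (simp add: sum.distrib sum.delta)
  also have "(if j + 1 < ?n then coeff (P i) (?n - 1 - (j + 1)) else 0)
      = coeff (pCons 0 (P i)) (?n - 1 - j)"
    using ij by (auto simp: coeff_pCons split: nat.splits intro!: arg_cong[of _ _ "coeff (P i)"])
  finally show ?case using ij by simp
qed (auto simp: companion_mat_def)

lemma row_mat_mult_companion_pow:
  fixes P :: "nat \<Rightarrow> 'a::idom poly"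
  assumes g: "lead_coeff g = 1" and P: "\<And>i. i < k \<Longrightarrow> degree_lt (degree g) (P i)"
  shows "\<exists>Q. row_mat k (degree g) P * companion_mat g ^\<^sub>m l = row_mat k (degree g) Q
     \<and> (\<forall>i<k. degree_lt (degree g) (Q i) \<and> g dvd monom 1 l * P i - Q i)"
proof (induction l)
  case 0
  have "row_mat k (degree g) P * companion_mat g ^\<^sub>m 0 = row_mat k (degree g) P"
    by (simp add: companion_mat_def)
  then show ?case using P by (intro exI[of _ P]) simp
next
  case (Suc l)
  let ?n = "degree g"
  let ?C = "companion_mat g"
  from Suc obtain Q where Q: "row_mat k ?n P * ?C ^\<^sub>m l = row_mat k ?n Q"
    "\<And>i. i < k \<Longrightarrow> degree_lt ?n (Q i)" "\<And>i. i < k \<Longrightarrow> g dvd monom 1 l * P i - Q i" by blast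
  let ?Q = "\<lambda>i. pCons 0 (Q i) - smult (coeff (Q i) (?n - 1)) g"
  have "row_mat k ?n P * ?C ^\<^sub>m Suc l = row_mat k ?n Q * ?C"
    unfolding pow_mat.simps Q(1)[symmetric]
    by (rule assoc_mult_mat[symmetric, of _ k ?n _ ?n _ ?n]) (auto intro: pow_carrier_mat)
  also have "\<dots> = row_mat k ?n ?Q" by (rule row_mat_mult_companion)
  finally have eq: "row_mat k ?n P * ?C ^\<^sub>m Suc l = row_mat k ?n ?Q" .
  moreover have "degree_lt ?n (?Q i) \<and> g dvd monom 1 (Suc l) * P i - ?Q i" if i: "i < k" for i
  proof
    show "degree_lt ?n (?Q i)"
    proof (intro allI impI)
      fix j assume j: "?n \<le> j"
      show "coeff (?Q i) j = 0"
      proof (cases "j = ?n")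
        case True
        then show ?thesis using g Q(2)[OF i] by (cases j) (auto simp: coeff_pCons split: nat.splits)
      next
        case False
        then show ?thesis using j Q(2)[OF i] by (cases j) (auto simp: coeff_eq_0)
      qed
    qed
    have "monom 1 (Suc l) * P i - ?Q i
        = [:0, 1:] * (monom 1 l * P i - Q i) + smult (coeff (Q i) (?n - 1)) g"
      by (simp add: monom_Suc algebra_simps)
    then show "g dvd monom 1 (Suc l) * P i - ?Q i"
      using Q(3)[OF i] by (metis dvd_add dvd_mult dvd_refl dvd_smult)
  qed
  ultimately show ?case by (intro exI[of _ ?Q]) blast
qed

lemma poly_mat_carrier_index:
  fixes A :: "'a::comm_ring_1 mat"
  assumes A: "A \<in> carrier_mat n n"
  shows "poly_mat f A \<in> carrier_mat n n"
    and "i < n \<Longrightarrow> j < n \<Longrightarrow> poly_mat f A $$ (i, j) = (\<Sum>l\<le>degree f. coeff f l * (A ^\<^sub>m l) $$ (i, j))"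
proof -
  let ?R = "ring_mat TYPE('a) n ()"
  let ?t = "\<lambda>l. coeff f l \<cdot>\<^sub>m (A ^\<^sub>m l)"
  interpret R: ring ?R by (rule ring_mat)
  have t: "?t l \<in> carrier_mat n n" for l using A by auto
  have *: "finsum ?R ?t S \<in> carrier_mat n n \<and> (\<forall>i<n. \<forall>j<n. finsum ?R ?t S $$ (i, j)
       = (\<Sum>l\<in>S. coeff f l * (A ^\<^sub>m l) $$ (i, j)))" if "finite S" for S
    using that
  proof induction
    case empty
    then show ?case by (simp add: ring_mat_simps)
  next
    case (insert x S)
    have "finsum ?R ?t (insert x S) = ?t x + finsum ?R ?t S"
      using insert t by (subst R.finsum_insert) (auto simp: ring_mat_simps)
    with insert t A show ?case by auto
  qed
  have dim: "dim_row A = n" using A by simp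
  show "poly_mat f A \<in> carrier_mat n n"
    and "i < n \<Longrightarrow> j < n \<Longrightarrow> poly_mat f A $$ (i, j) = (\<Sum>l\<le>degree f. coeff f l * (A ^\<^sub>m l) $$ (i, j))"
    using *[of "{..degree f}"] unfolding poly_mat_def dim by auto
qed

lemma poly_mat_companion_carrier [simp]:
  "poly_mat f (companion_mat g) \<in> carrier_mat (degree g) (degree g)"
  by (rule poly_mat_carrier_index) simp

text \<open>
  This is the link between matrices and polynomials on which everything below rests: \<open>f(C\<^sub>g)\<close> acts
  on coefficient vectors as multiplication by \<open>f\<close> modulo \<open>g\<close>. Remainders being
  unique, a candidate \<open>Q\<close> only has to be congruent to \<open>f P\<close> and of small degree.
\<close>

lemma row_mat_mult_poly_mat_companion:
  fixes P :: "nat \<Rightarrow> 'a::idom poly"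
  assumes g: "lead_coeff g = 1" and P: "\<And>i. i < k \<Longrightarrow> degree_lt (degree g) (P i)"
    and Q: "\<And>i. i < k \<Longrightarrow> degree_lt (degree g) (Q i)"
    and dvd: "\<And>i. i < k \<Longrightarrow> g dvd f * P i - Q i"
  shows "row_mat k (degree g) P * poly_mat f (companion_mat g) = row_mat k (degree g) Q"
proof -
  let ?n = "degree g"
  let ?C = "companion_mat g"
  obtain S where S: "\<And>l. row_mat k ?n P * ?C ^\<^sub>m l = row_mat k ?n (S l)"
    "\<And>l i. i < k \<Longrightarrow> degree_lt ?n (S l i)" "\<And>l i. i < k \<Longrightarrow> g dvd monom 1 l * P i - S l i"
    using row_mat_mult_companion_pow[where k = k and P = P, OF g P] by metis
  have Q_eq: "Q i = (\<Sum>l\<le>degree f. smult (coeff f l) (S l i))" if i: "i < k" for i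
  proof -
    let ?S = "\<Sum>l\<le>degree f. smult (coeff f l) (S l i)"
    have "f * P i = (\<Sum>l\<le>degree f. monom (coeff f l) l) * P i"
      by (simp add: poly_as_sum_of_monoms)
    also have "\<dots> = (\<Sum>l\<le>degree f. smult (coeff f l) (monom 1 l * P i))"
      unfolding sum_distrib_right
      by (rule sum.cong) (auto simp: smult_monom simp flip: mult_smult_left)
    finally have "f * P i - ?S = (\<Sum>l\<le>degree f. smult (coeff f l) (monom 1 l * P i - S l i))"
      by (simp add: smult_diff_right sum_subtractf)
    then have "g dvd f * P i - ?S"
      using S(3)[OF i] by (auto intro!: dvd_sum dvd_smult)
    then have "g dvd (f * P i - ?S) - (f * P i - Q i)"
      using dvd[OF i] by (rule dvd_diff)
    then have "g dvd Q i - ?S" by simp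
    moreover have "degree_lt ?n (Q i - ?S)"
      using Q[OF i] S(2)[OF i] by (simp add: coeff_sum)
    ultimately have "Q i - ?S = 0" by (rule dvd_degree_lt_imp_0)
    then show ?thesis by simp
  qed
  show ?thesis
  proof (rule eq_matI, goal_cases)
    case (1 i j)
    then have ij: "i < k" "j < ?n" by auto
    have C: "?C ^\<^sub>m l \<in> carrier_mat ?n ?n" for l by (rule pow_carrier_mat) simp
    have "(row_mat k ?n P * poly_mat f ?C) $$ (i, j)
      = (\<Sum>a<?n. coeff (P i) (?n - 1 - a) * (\<Sum>l\<le>degree f. coeff f l * (?C ^\<^sub>m l) $$ (a, j)))"
      using ij poly_mat_carrier_index(1)[of ?C ?n f]
      by (simp add: scalar_prod_def atLeast0LessThan poly_mat_carrier_index(2)[of ?C ?n] 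
          del: poly_mat_companion_carrier)
    also have "\<dots> = (\<Sum>l\<le>degree f. \<Sum>a<?n. coeff f l * (coeff (P i) (?n - 1 - a) * (?C ^\<^sub>m l) $$ (a, j)))"
      unfolding sum_distrib_left by (subst sum.swap) (simp add: ac_simps)
    also have "\<dots> = (\<Sum>l\<le>degree f. coeff f l * (row_mat k ?n P * ?C ^\<^sub>m l) $$ (i, j))"
      using ij carrier_matD[OF C] by (auto simp: scalar_prod_def atLeast0LessThan sum_distrib_left intro!: sum.cong)
    also have "\<dots> = coeff (Q i) (?n - 1 - j)"
      unfolding S(1) Q_eq[OF ij(1)] using ij by (simp add: coeff_sum)
    finally show ?case using ij by simp
  qed (use carrier_matD[OF poly_mat_companion_carrier[of f g]] in auto)
qed

lemma poly_mat_companion_eq_row_mat: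
  fixes g :: "'a::idom poly"
  assumes g: "lead_coeff g = 1"
    and Q: "\<And>i. i < degree g \<Longrightarrow> degree_lt (degree g) (Q i)"
    and dvd: "\<And>i. i < degree g \<Longrightarrow> g dvd f * monom 1 (degree g - 1 - i) - Q i"
  shows "poly_mat f (companion_mat g) = row_mat (degree g) (degree g) Q"
proof -
  let ?n = "degree g"
  have "poly_mat f (companion_mat g) = 1\<^sub>m ?n * poly_mat f (companion_mat g)"
    by (rule left_mult_one_mat[symmetric, OF poly_mat_companion_carrier])
  also have "\<dots> = row_mat ?n ?n (\<lambda>i. monom 1 (?n - 1 - i)) * poly_mat f (companion_mat g)"
    by (simp only: one_mat_eq_row_mat)
  also have "\<dots> = row_mat ?n ?n Q"
    by (rule row_mat_mult_poly_mat_companion[OF g _ Q dvd]) (auto simp: coeff_monom)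
  finally show ?thesis .
qed

section \<open>The product formula for the determinant\<close>

lemma det_upper_unitriangular:
  fixes A :: "'a::idom mat"
  assumes A: "A \<in> carrier_mat n n"
    and unitri: "\<And>i j. j \<le> i \<Longrightarrow> i < n \<Longrightarrow> A $$ (i, j) = (if i = j then 1 else 0)"
  shows "det A = 1"
proof -
  have "det A = prod_list (diag_mat A)"
    using A by (intro det_upper_triangular) (auto simp: unitri)
  also have "diag_mat A = replicate n 1"
    using A by (intro nth_equalityI) (auto simp: diag_mat_def unitri)
  finally show ?thesis by simp
qed

text \<open>
  In the basis \<open>z t\<^sup>k\<^sup>-\<^sup>1, \<dots>, z, t\<^sup>m\<^sup>-\<^sup>1, \<dots>, 1\<close> of \<open>R[t]/(z G)\<close> multiplication by \<open>f\<close>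
  is block triangular: the multiples of \<open>z\<close> form an invariant submodule isomorphic to \<open>R[t]/(G)\<close>,
  with quotient \<open>R[t]/(z)\<close>. The base change from the standard basis is unitriangular because \<open>z\<close> is monic.
\<close>

lemma det_poly_mat_companion_mult:
  fixes f z G :: "'a::idom poly"
  assumes z: "lead_coeff z = 1" and G: "lead_coeff G = 1"
  shows "det (poly_mat f (companion_mat (z * G)))
    = det (poly_mat f (companion_mat G)) * det (poly_mat f (companion_mat z))"
proof -
  define k m n where kmn: "k = degree G" "m = degree z" "n = degree (z * G)"
  have z0: "z \<noteq> 0" and G0: "G \<noteq> 0" using z G by auto
  then have n: "n = k + m" by (simp add: kmn degree_mult_eq)
  have zG: "lead_coeff (z * G) = 1" using z G by (simp add: lead_coeff_mult)
  \<comment> \<open>\<open>R\<close> and \<open>S\<close> are the rows of the two diagonal blocks; dividing \<open>f t\<^sup>i\<close> by \<open>z G\<close> leaves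
      \<open>z W + S\<close>, so \<open>W\<close> gives the rows of the off-diagonal block.\<close>
  define R where "R = (\<lambda>i. pseudo_mod (f * monom 1 (k - 1 - i)) G)"
  define S where "S = (\<lambda>i. pseudo_mod (f * monom 1 (m - 1 - i)) z)"
  have R: "\<And>i. degree_lt k (R i)" "\<And>i. G dvd f * monom 1 (k - 1 - i) - R i"
    unfolding R_def kmn by (rule degree_lt_pseudo_mod[OF G0]) (rule monic_dvd_diff_pseudo_mod[OF G])
  have S: "\<And>i. degree_lt m (S i)" "\<And>i. z dvd f * monom 1 (m - 1 - i) - S i"
    unfolding S_def kmn by (rule degree_lt_pseudo_mod[OF z0]) (rule monic_dvd_diff_pseudo_mod[OF z])
  have "\<forall>i. \<exists>q. f * monom 1 (m - 1 - i) - S i = z * q"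
    using S(2) unfolding dvd_def by blast
  from choice[OF this] obtain q where "\<forall>i. f * monom 1 (m - 1 - i) - S i = z * q i" ..
  then have q: "\<And>i. f * monom 1 (m - 1 - i) - S i = z * q i" by blast
  define W where "W = (\<lambda>i. pseudo_mod (q i) G)"
  have W: "\<And>i. degree_lt k (W i)" "\<And>i. z * G dvd f * monom 1 (m - 1 - i) - S i - z * W i"
    unfolding W_def q right_diff_distrib[symmetric] unfolding kmn
    by (rule degree_lt_pseudo_mod[OF G0])
      (rule mult_dvd_mono[OF dvd_refl monic_dvd_diff_pseudo_mod[OF G]])
  \<comment> \<open>\<open>U\<close> lists the new basis, \<open>V\<close> its images under multiplication by \<open>f\<close>.\<close>
  define U where "U = (\<lambda>i. if i < k then z * monom 1 (k - 1 - i) else monom 1 (n - 1 - i))"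
  define V where "V = (\<lambda>i. if i < k then z * R i else z * W (i - k) + S (i - k))"
  have coeff_U: "coeff (U i) (n - 1 - j) = (if i = j then 1 else 0)" if "j \<le> i" "i < n" for i j
  proof (cases "i < k")
    case True
    then have "coeff (U i) (n - 1 - j) = coeff (z * monom 1 (k - 1 - i)) (n - 1 - j)"
      by (simp add: U_def)
    also have "\<dots> = (if i = j then 1 else 0)"
      by (rule coeff_monic_shift[OF z _ that(1) True]) (use n in \<open>simp add: kmn\<close>)
    finally show ?thesis .
  qed (use that n in \<open>auto simp: U_def coeff_monom\<close>)
  have lt_U: "degree_lt n (U i)" if "i < n" for i
  proof (cases "i < k")
    case True
    then have "degree_lt k (monom (1 :: 'a) (k - 1 - i))" by (auto simp: coeff_monom)
    from degree_lt_mult[OF this, of z] True n show ?thesis by (simp add: U_def kmn)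
  qed (use that in \<open>auto simp: U_def coeff_monom\<close>)
  have lt_V: "degree_lt n (V i)" for i
    using degree_lt_mult[OF R(1), of z] degree_lt_mult[OF W(1), of z] S(1) n
    by (auto simp: V_def kmn)
  have det_U: "det (row_mat n n U) = 1"
    by (rule det_upper_unitriangular[OF row_mat_carrier]) (use coeff_U in auto)
  let ?M = "poly_mat f (companion_mat (z * G))"
  let ?N = "poly_mat f (companion_mat G)"
  let ?L = "poly_mat f (companion_mat z)"
  have M: "?M \<in> carrier_mat n n" and N: "?N \<in> carrier_mat k k" and L: "?L \<in> carrier_mat m m"
    unfolding kmn by (rule poly_mat_companion_carrier)+
  have UM: "row_mat n n U * ?M = row_mat n n V"
    unfolding kmn(3)
  proof (rule row_mat_mult_poly_mat_companion[OF zG], fold kmn(3))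
    fix i assume i: "i < n"
    show "degree_lt n (U i)" "degree_lt n (V i)" using lt_U lt_V i by auto
    show "z * G dvd f * U i - V i"
    proof (cases "i < k")
      case True
      have "z * G dvd z * (f * monom 1 (k - 1 - i) - R i)"
        by (rule mult_dvd_mono) (use R in auto)
      then show ?thesis using True by (simp add: U_def V_def algebra_simps)
    next
      case False
      then have "n - 1 - i = m - 1 - (i - k)" using n by simp
      then show ?thesis using False W(2)[of "i - k"] by (simp add: U_def V_def algebra_simps)
    qed
  qed
  \<comment> \<open>The coordinates of \<open>z a + b\<close> in the new basis are the coefficients of \<open>t\<^sup>m a + b\<close>.\<close>
  define T where "T = (\<lambda>i. if i < k then monom 1 m * R i else monom 1 m * W (i - k) + S (i - k))"
  have N_eq: "?N = row_mat k k R"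
    unfolding kmn(1) by (rule poly_mat_companion_eq_row_mat[OF G]; fold kmn(1)) (use R in auto)
  have L_eq: "?L = row_mat m m S"
    unfolding kmn(2) by (rule poly_mat_companion_eq_row_mat[OF z]; fold kmn(2)) (use S in auto)
  have T_eq: "row_mat n n T = four_block_mat ?N (0\<^sub>m k m) (row_mat m k W) ?L"
  proof (rule eq_matI, goal_cases)
    case (1 i j)
    then have ij: "i < n" "j < n" using N L n by auto
    show ?case
    proof (cases "j < k")
      case True
      then have "n - 1 - j = m + (k - 1 - j)" "m + (k - 1 - j) \<ge> m" using n by auto
      then show ?thesis using ij True S(1) n unfolding N_eq L_eq
        by (auto simp: T_def coeff_monom_mult)
    next
      case False
      then have "n - 1 - j = m - 1 - (j - k)" "m - 1 - (j - k) < m" using n ij by auto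
      then show ?thesis using ij False n unfolding N_eq L_eq
        by (auto simp: T_def coeff_monom_mult)
    qed
  qed (use N L n in auto)
  have "row_mat n n T * row_mat n n U = row_mat n n V"
    unfolding row_mat_mult_row_mat
  proof (rule row_mat_cong)
    fix i assume i: "i < n"
    have new_basis: "(\<Sum>l<n. smult (coeff (monom 1 m * a + b) l) (U (n - 1 - l))) = z * a + b"
      if a: "degree_lt k a" and b: "degree_lt m b" for a b
    proof -
      let ?h = "\<lambda>l. smult (coeff (monom 1 m * a + b) l) (U (n - 1 - l))"
      have "sum ?h {..<n} = sum ?h {..<m} + sum ?h {m..<n}"
        using n by (subst sum.union_disjoint[symmetric]) (auto intro: sum.cong)
      also have "sum ?h {..<m} = (\<Sum>l<m. smult (coeff b l) (1 * monom 1 l))"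
        using n by (intro sum.cong) (auto simp: coeff_monom_mult U_def)
      also have "\<dots> = 1 * b" by (rule sum_smult_monom_eq[OF b])
      also have "sum ?h {m..<n} = (\<Sum>l<k. ?h (m + l))"
        by (rule sum.reindex_bij_witness[of _ "\<lambda>l. m + l" "\<lambda>l. l - m"]) (use n in auto)
      also have "\<dots> = (\<Sum>l<k. smult (coeff a l) (z * monom 1 l))"
        using n b by (intro sum.cong) (auto simp: coeff_monom_mult U_def intro!: arg_cong2[of _ _ _ _ monom])
      also have "\<dots> = z * a" by (rule sum_smult_monom_eq[OF a])
      finally show ?thesis by simp
    qed
    show "(\<Sum>l<n. smult (coeff (T i) l) (U (n - 1 - l))) = V i"
      using new_basis[OF R(1), of 0 i] new_basis[OF W(1) S(1), of "i - k" "i - k"]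
      by (cases "i < k") (simp_all add: T_def V_def)
  qed
  then have "det (row_mat n n T) * det (row_mat n n U) = det (row_mat n n U) * det ?M"
    using UM M by (metis det_mult row_mat_carrier)
  then have "det ?M = det (row_mat n n T)" using det_U by simp
  also have "\<dots> = det ?N * det ?L"
    unfolding T_eq by (rule det_four_block_mat_upper_right_zero[OF N refl _ L]) simp
  finally show ?thesis .
qed

lemma det_poly_mat_companion_linear:
  fixes f :: "'a::idom poly"
  shows "det (poly_mat f (companion_mat [:- x, 1:])) = poly f x"
proof -
  have "poly_mat f (companion_mat [:- x, 1:]) = row_mat 1 1 (\<lambda>_. [:poly f x:])"
    using poly_mat_companion_eq_row_mat[of "[:- x, 1:]" "\<lambda>_. [:poly f x:]" f]
    by (auto simp: coeff_pCons poly_eq_0_iff_dvd[symmetric] split: nat.splits)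
  then show ?thesis by (simp add: det_single)
qed

lemma det_poly_mat_companion_roots:
  fixes f :: "'a::idom poly"
  shows "det (poly_mat f (companion_mat (\<Prod>x\<in>#A. [:- x, 1:]))) = (\<Prod>x\<in>#A. poly f x)"
proof (induction A)
  case empty
  have "poly_mat f (companion_mat 1) \<in> carrier_mat 0 0"
    using poly_mat_companion_carrier[of f 1] by simp
  then show ?case by simp
next
  case (add x A)
  have "lead_coeff (\<Prod>x\<in>#A. [:- x, 1:]) = 1"
    by (induction A) (simp_all add: lead_coeff_mult del: mult_pCons_left)
  then show ?case
    using add det_poly_mat_companion_mult[of "[:- x, 1:]" "\<Prod>x\<in>#A. [:- x, 1:]" f]
    by (simp add: det_poly_mat_companion_linear mult.commute del: mult_pCons_left)
qed

lemma det_poly_mat_companion_eq_prod_proots: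
  fixes f g :: "'a::alg_closed_field poly"
  assumes "lead_coeff g = 1"
  shows "det (poly_mat f (companion_mat g)) = (\<Prod>x\<in>#proots g. poly f x)"
proof -
  have "g \<noteq> 0" using assms by auto
  from alg_closed_imp_factorization[OF this] assms
  obtain A where A: "g = (\<Prod>x\<in>#A. [:- x, 1:])" by auto
  have "proots (\<Prod>x\<in>#A. [:- x, 1:]) = A"
  proof (induction A)
    case (add x A)
    have "(\<Prod>x\<in>#A. [:- x, 1:]) \<noteq> 0" by (induction A) (auto simp del: mult_pCons_left)
    with add show ?case by (simp add: proots_mult del: mult_pCons_left)
  qed simp
  then show ?thesis unfolding A by (simp add: det_poly_mat_companion_roots)
qed

text \<open>
  Only the division relations that determine the rows of \<open>f(C\<^sub>g)\<close> have to be transported.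
  Injectivity of \<open>\<phi>\<close> preserves degrees, hence the size of the companion matrix.
\<close>

lemma det_poly_mat_companion_hom:
  fixes \<phi> :: "'a::idom \<Rightarrow> 'b::idom"
  assumes \<phi>: "inj_comm_ring_hom \<phi>" and g: "lead_coeff g = 1"
  shows "det (poly_mat (map_poly \<phi> f) (companion_mat (map_poly \<phi> g)))
    = \<phi> (det (poly_mat f (companion_mat g)))"
proof -
  interpret inj_comm_ring_hom \<phi> by (rule \<phi>)
  interpret P: map_poly_inj_comm_ring_hom \<phi> ..
  let ?n = "degree g"
  have g0: "g \<noteq> 0" using g by auto
  define Q where "Q = (\<lambda>i. pseudo_mod (f * monom 1 (?n - 1 - i)) g)"
  have Q: "\<And>i. degree_lt ?n (Q i)" "\<And>i. g dvd f * monom 1 (?n - 1 - i) - Q i"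
    unfolding Q_def by (rule degree_lt_pseudo_mod[OF g0]) (rule monic_dvd_diff_pseudo_mod[OF g])
  have deg: "degree (map_poly \<phi> g) = ?n" by simp
  have "poly_mat (map_poly \<phi> f) (companion_mat (map_poly \<phi> g))
      = row_mat (degree (map_poly \<phi> g)) (degree (map_poly \<phi> g)) (\<lambda>i. map_poly \<phi> (Q i))"
  proof (rule poly_mat_companion_eq_row_mat, unfold deg)
    show "coeff (map_poly \<phi> g) ?n = 1" using g by simp
    fix i
    show "degree_lt ?n (map_poly \<phi> (Q i))" using Q(1) by simp
    have "map_poly \<phi> g dvd map_poly \<phi> (f * monom 1 (?n - 1 - i) - Q i)"
      using Q(2) by (rule P.hom_dvd)
    then show "map_poly \<phi> g dvd map_poly \<phi> f * monom 1 (?n - 1 - i) - map_poly \<phi> (Q i)"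
      by (simp add: P.hom_minus P.hom_mult)
  qed
  also have "\<dots> = map_mat \<phi> (row_mat ?n ?n Q)"
    by (rule eq_matI) auto
  also have "row_mat ?n ?n Q = poly_mat f (companion_mat g)"
    by (rule poly_mat_companion_eq_row_mat[symmetric, OF g]) (use Q in auto)
  finally show ?thesis by simp
qed

section \<open>Bezout domains and unimodular polynomials\<close>

text \<open>
  The defining equation of an elementary divisor domain with third element \<open>0\<close>.
\<close>

lemma ex_bezout_gcd:
  fixes a b :: "'a::elementary_divisor_domain"
  shows "\<exists>d x y. d dvd a \<and> d dvd b \<and> d = x * a + y * b"
proof -
  obtain d x y z w where d: "is_gcd_of {a, b, 0} d" "d = z * x * a + z * y * b + w * y * 0"
    using elementary_divisor[of a b 0] by blast
  then have "d dvd a" "d dvd b" "d = (z * x) * a + (z * y) * b"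
    by (auto simp: is_gcd_of_def)
  then show ?thesis by blast
qed

text \<open>
  The coefficients generate the unit ideal. In a Bezout domain this is the same as being primitive,
  but the linear combination is what the divisibility argument below uses.
\<close>

definition unimodular_poly :: "'a::comm_ring_1 poly \<Rightarrow> bool" where
  "unimodular_poly q \<longleftrightarrow> (\<exists>N c. (\<Sum>i\<le>N. c i * coeff q i) = 1)"

lemma unimodular_polyI: "(\<Sum>i\<le>N. c i * coeff q i) = 1 \<Longrightarrow> unimodular_poly q"
  unfolding unimodular_poly_def by (intro exI)

lemma ex_unimodular_part:
  fixes p :: "'a::elementary_divisor_domain poly"
  shows "\<exists>d q. p = smult d q \<and> unimodular_poly q"
proof (induction p)
  case 0
  have "unimodular_poly (1 :: 'a poly)"
    by (rule unimodular_polyI[of "\<lambda>_. 1" _ 0]) simp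
  then show ?case by (metis smult_0_left)
next
  case (pCons a p)
  then obtain d q where p: "p = smult d q" and q: "unimodular_poly q" by blast
  from q obtain N c where c: "(\<Sum>i\<le>N. c i * coeff q i) = 1"
    unfolding unimodular_poly_def by blast
  obtain e x y where e: "e dvd a" "e dvd d" "e = x * a + y * d"
    using ex_bezout_gcd by blast
  then obtain a' d' where ad: "a = e * a'" "d = e * d'" by (meson dvdE)
  show ?case
  proof (cases "e = 0")
    case True
    then show ?thesis using ad p pCons by simp
  next
    case False
    have "e * 1 = e * (x * a' + y * d')"
      using e(3) ad by (simp add: algebra_simps)
    with False have 1: "x * a' + y * d' = 1" by (metis mult_left_cancel)
    let ?q = "pCons a' (smult d' q)"
    have "(\<Sum>i\<le>Suc N. case_nat x (\<lambda>i. y * c i) i * coeff ?q i)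
        = x * a' + y * d' * (\<Sum>i\<le>N. c i * coeff q i)"
      by (subst sum.atMost_Suc_shift) (simp add: sum_distrib_left algebra_simps)
    also have "\<dots> = 1" using 1 c by simp
    finally have "unimodular_poly ?q" by (rule unimodular_polyI)
    moreover have "pCons a p = smult e ?q" using p ad by simp
    ultimately show ?thesis by blast
  qed
qed

text \<open>
  A Gauss lemma without prime elements. It follows McCoy's argument on zero divisors of
  \<open>(R/a)[t]\<close>: by induction on the degree of \<open>h\<close>, every coefficient of \<open>q\<close> annihilates \<open>h\<close>
  modulo \<open>a\<close>, and since these coefficients generate the unit ideal, \<open>h\<close> vanishes modulo \<open>a\<close>.
\<close>

lemma const_dvd_mult_unimodularD:
  fixes h q :: "'a::idom poly"
  assumes q: "unimodular_poly q" and dvd: "[:a:] dvd h * q"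
  shows "[:a:] dvd h"
  using dvd
proof (induction "degree h" arbitrary: h rule: less_induct)
  case less
  note IH = less.hyps and h = less.prems
  let ?n = "degree h"
  have scaled: "[:a:] dvd smult (coeff q i) h" for i
  proof (induction "degree q - i" arbitrary: i rule: less_induct)
    case (less i)
    have IHi: "[:a:] dvd smult (coeff q j) h" if "j > i" for j
    proof (cases "j \<le> degree q")
      case True
      then show ?thesis using less that by simp
    next
      case False
      then show ?thesis by (simp add: coeff_eq_0)
    qed
    \<comment> \<open>All coefficients of \<open>q\<close> above \<open>i\<close> annihilate \<open>h\<close> modulo \<open>a\<close>, so the coefficient of \<open>h q\<close>
        in degree \<open>deg h + i\<close> reduces to one product modulo \<open>a\<close>.\<close>
    have "coeff (h * q) (?n + i) = (\<Sum>j\<le>?n + i. coeff h j * coeff q (?n + i - j))"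
      by (simp add: coeff_mult)
    also have "\<dots> = (\<Sum>j\<in>{..?n + i} - {?n}. coeff h j * coeff q (?n + i - j)) + lead_coeff h * coeff q i"
      by (subst sum.remove[of _ ?n]) auto
    finally have split: "lead_coeff h * coeff q i = coeff (h * q) (?n + i)
        - (\<Sum>j\<in>{..?n + i} - {?n}. coeff h j * coeff q (?n + i - j))" by simp
    have "a dvd coeff h j * coeff q (?n + i - j)" if "j \<in> {..?n + i} - {?n}" for j
    proof (cases "j > ?n")
      case True
      then show ?thesis by (simp add: coeff_eq_0)
    next
      case False
      with that have "?n + i - j > i" by auto
      from IHi[OF this] show ?thesis
        by (auto simp: const_poly_dvd_iff mult.commute)
    qed
    then have "a dvd lead_coeff h * coeff q i"
      unfolding split using h
      by (intro dvd_diff dvd_sum) (auto simp: const_poly_dvd_iff)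
    then have lead: "[:a:] dvd monom (coeff q i * lead_coeff h) ?n"
      by (auto simp: const_poly_dvd_iff mult.commute)
    \<comment> \<open>Without its leading term, which vanishes modulo \<open>a\<close>, the multiple of \<open>h\<close> has smaller degree
        and the outer induction hypothesis applies.\<close>
    define h' where "h' = smult (coeff q i) h - monom (coeff q i * lead_coeff h) ?n"
    have "h' * q = smult (coeff q i) (h * q) - monom (coeff q i * lead_coeff h) ?n * q"
      unfolding h'_def by (simp add: algebra_simps)
    then have dvd': "[:a:] dvd h' * q"
      using h lead by (simp add: dvd_diff dvd_smult)
    have "[:a:] dvd h'"
    proof (cases "?n = 0")
      case True
      then have "h' = 0" unfolding h'_def
        by (metis degree_0_id diff_self monom_0 smult_pCons smult_0_right)
      then show ?thesis by simp
    next
      case False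
      have "degree h' \<le> ?n - 1"
      proof (rule degree_le, intro allI impI)
        fix i assume "?n - 1 < i"
        then show "coeff h' i = 0"
          using False by (cases "i = ?n") (auto simp: h'_def coeff_eq_0)
      qed
      then have "degree h' < degree h" using False by simp
      with dvd' show ?thesis by (rule IH[rotated])
    qed
    with lead show ?case unfolding h'_def by (metis dvd_add_left_iff diff_add_cancel)
  qed
  from q obtain N c where c: "(\<Sum>i\<le>N. c i * coeff q i) = 1"
    unfolding unimodular_poly_def by blast
  have "a dvd coeff h j" for j
  proof -
    have "a dvd coeff q i * coeff h j" for i
      using scaled[of i] by (auto simp: const_poly_dvd_iff)
    then have "a dvd (\<Sum>i\<le>N. c i * (coeff q i * coeff h j))"
      by (intro dvd_sum) (rule dvd_mult)
    also have "\<dots> = (\<Sum>i\<le>N. c i * coeff q i) * coeff h j"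
      by (simp add: sum_distrib_right mult.assoc)
    finally show ?thesis by (simp add: c)
  qed
  then show ?case by (simp add: const_poly_dvd_iff)
qed

lemma monic_dvd_smultD:
  fixes g p :: "'a::idom poly"
  assumes g: "lead_coeff g = 1" and d: "d \<noteq> 0" and dvd: "g dvd smult d p"
  shows "g dvd p"
proof -
  have g0: "g \<noteq> 0" using g by auto
  let ?r = "pseudo_mod p g"
  have "g dvd smult d p - smult d (p - ?r)"
    using dvd dvd_smult[OF monic_dvd_diff_pseudo_mod[OF g]] by (rule dvd_diff)
  then have "g dvd smult d ?r" by (simp add: smult_diff_right)
  moreover have "degree_lt (degree g) (smult d ?r)" using degree_lt_pseudo_mod[OF g0] by simp
  ultimately have "smult d ?r = 0" by (rule dvd_degree_lt_imp_0)
  with d have "?r = 0" by simp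
  then show ?thesis using monic_dvd_diff_pseudo_mod[OF g, of p] by simp
qed

text \<open>
  Let \<open>q\<close> have minimal degree among the nonzero polynomials whose product with \<open>F\<close> is divisible by
  \<open>G\<close>; up to a constant, it is \<open>G\<close> divided by the greatest common divisor of \<open>F\<close> and
  \<open>G\<close> over the field of fractions. The Gauss lemma shows that \<open>q\<close> divides \<open>G\<close> over \<open>R\<close>. The cofactor
  is a common divisor of \<open>F\<close> and \<open>G\<close>, hence a unit, so \<open>q\<close> has the degree of \<open>G\<close>.
\<close>

lemma coprime_monic_dvd_mult_imp_degree_le:
  fixes F G p :: "'a::elementary_divisor_domain poly"
  assumes G: "lead_coeff G = 1"
    and coprime: "\<And>w. w dvd F \<Longrightarrow> w dvd G \<Longrightarrow> w dvd 1"
    and p: "p \<noteq> 0" "G dvd F * p"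
  shows "degree G \<le> degree p"
proof -
  define m where "m = (LEAST m. \<exists>p. p \<noteq> 0 \<and> G dvd F * p \<and> degree p = m)"
  have "\<exists>p. p \<noteq> 0 \<and> G dvd F * p \<and> degree p = m"
    unfolding m_def by (rule LeastI_ex) (use p in blast)
  then obtain p0 where p0: "p0 \<noteq> 0" "G dvd F * p0" "degree p0 = m" by blast
  have least: "m \<le> degree s" if "s \<noteq> 0" "G dvd F * s" for s
    unfolding m_def by (rule Least_le) (use that in blast)
  obtain d q where dq: "p0 = smult d q" "unimodular_poly q"
    using ex_unimodular_part by blast
  with p0 have d: "d \<noteq> 0" and q0: "q \<noteq> 0" and deg_q: "degree q = m" by auto
  have "G dvd smult d (F * q)" using p0(2) dq by simp
  with G d have Fq: "G dvd F * q" by (rule monic_dvd_smultD)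
  \<comment> \<open>The remainder of \<open>G\<close> modulo \<open>q\<close> vanishes by minimality, and unimodularity of \<open>q\<close> removes
      the factor \<open>a\<close> that pseudo-division introduces.\<close>
  obtain a s r where a: "a \<noteq> 0" "smult a G = q * s + r" and r: "r = 0 \<or> degree r < degree q"
    using pseudo_mod[OF q0, of G] by metis
  have "F * r = smult a (G * F) - F * q * s"
    using arg_cong[OF a(2), of "\<lambda>x. F * x"] by (simp add: algebra_simps)
  then have "G dvd F * r" using Fq by (simp add: dvd_smult)
  with least[of r] r deg_q have "r = 0" by fastforce
  with a have aG: "smult a G = s * q" by (simp add: mult.commute)
  then have "s * q = [:a:] * G" by simp
  then have "[:a:] dvd s * q" by (rule dvdI)
  with dq(2) have "[:a:] dvd s" by (rule const_dvd_mult_unimodularD)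
  then obtain t where "s = smult a t" by (auto elim!: dvdE)
  with aG have "smult a (G - q * t) = 0" by (simp add: smult_diff_right mult.commute)
  with a(1) have Gqt: "G = q * t" by (simp only: smult_eq_0_iff) simp
  from Fq obtain v where "F * q = G * v" by (elim dvdE)
  then have "q * F = q * (t * v)" using Gqt by (simp add: ac_simps)
  with q0 have "F = t * v" by (metis mult_left_cancel)
  then have "t dvd 1" using coprime[of t] Gqt by simp
  then have "degree t = 0" by (auto simp: is_unit_poly_iff)
  moreover have "t \<noteq> 0" using Gqt G by auto
  ultimately have "degree G = degree q" using Gqt q0 by (simp add: degree_mult_eq)
  with deg_q least[OF p] show ?thesis by simp
qed

text \<open>
  A vector in the left kernel is a polynomial \<open>p\<close> of degree less than \<open>deg G\<close> such that
  \<open>G\<close> divides \<open>F p\<close>.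
\<close>

lemma det_poly_mat_companion_nonzero:
  fixes F G :: "'a::elementary_divisor_domain poly"
  assumes G: "lead_coeff G = 1"
    and coprime: "\<And>w. w dvd F \<Longrightarrow> w dvd G \<Longrightarrow> w dvd 1"
  shows "det (poly_mat F (companion_mat G)) \<noteq> 0"
proof
  let ?k = "degree G"
  let ?N = "poly_mat F (companion_mat G)"
  have N: "?N \<in> carrier_mat ?k ?k" by simp
  have G0: "G \<noteq> 0" using G by auto
  assume "det ?N = 0"
  then have "det (transpose_mat ?N) = 0" using det_transpose[OF N] by simp
  then obtain v where v: "v \<in> carrier_vec ?k" "v \<noteq> 0\<^sub>v ?k" "transpose_mat ?N *\<^sub>v v = 0\<^sub>v ?k"
    using det_0_iff_vec_prod_zero[of "transpose_mat ?N" ?k] N by auto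
  define p where "p = (\<Sum>l<?k. monom (v $ (?k - 1 - l)) l)"
  have p_lt: "degree_lt ?k p" by (auto simp: p_def coeff_sum coeff_monom)
  have coeff_p: "coeff p (?k - 1 - j) = v $ j" if "j < ?k" for j
  proof -
    have "coeff p (?k - 1 - j) = (\<Sum>l<?k. if l = ?k - 1 - j then v $ (?k - 1 - l) else 0)"
      unfolding p_def coeff_sum by (rule sum.cong) (auto simp: coeff_monom)
    also have "\<dots> = v $ (?k - 1 - (?k - 1 - j))"
      using that by (subst sum.delta) auto
    also have "?k - 1 - (?k - 1 - j) = j" using that by simp
    finally show ?thesis .
  qed
  have "p \<noteq> 0"
  proof
    assume "p = 0"
    then have "v $ j = 0" if "j < ?k" for j using coeff_p[OF that] by simp
    then have "v = 0\<^sub>v ?k" using v(1) by (intro eq_vecI) auto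
    with v(2) show False by simp
  qed
  then have deg_p: "degree p < ?k" using p_lt by (rule degree_less_if_degree_lt)
  let ?r = "pseudo_mod (F * p) G"
  have mult: "row_mat 1 ?k (\<lambda>_. p) * ?N = row_mat 1 ?k (\<lambda>_. ?r)"
    by (rule row_mat_mult_poly_mat_companion[OF G])
      (use p_lt degree_lt_pseudo_mod[OF G0] monic_dvd_diff_pseudo_mod[OF G] in auto)
  have "coeff ?r l = 0" for l
  proof (cases "l < ?k")
    case True
    let ?j = "?k - 1 - l"
    have j: "?j < ?k" "?k - 1 - ?j = l" using True by auto
    have "coeff ?r l = row_mat 1 ?k (\<lambda>_. ?r) $$ (0, ?j)" using j by simp
    also have "\<dots> = (\<Sum>a<?k. coeff p (?k - 1 - a) * ?N $$ (a, ?j))"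
      using carrier_matD[OF N] j(1) unfolding mult[symmetric]
      by (simp add: scalar_prod_def atLeast0LessThan)
    also have "\<dots> = (\<Sum>a<?k. ?N $$ (a, ?j) * v $ a)"
      by (rule sum.cong) (use coeff_p in \<open>auto simp: mult.commute\<close>)
    also have "\<dots> = (transpose_mat ?N *\<^sub>v v) $ ?j"
      using carrier_matD[OF N] j(1) v(1) by (simp add: scalar_prod_def atLeast0LessThan)
    finally show ?thesis using v(3) j(1) by simp
  next
    case False
    then show ?thesis using degree_lt_pseudo_mod[OF G0] by simp
  qed
  then have "?r = 0" by (intro poly_eqI) simp
  then have "G dvd F * p" using monic_dvd_diff_pseudo_mod[OF G, of "F * p"] by simp
  from coprime_monic_dvd_mult_imp_degree_le[OF G coprime \<open>p \<noteq> 0\<close> this] deg_p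
  show False by simp
qed

section \<open>Minors and rank of a product of matrices\<close>

lemma submatrix_mult:
  fixes A B :: "'a::comm_ring_1 mat"
  assumes "dim_col A = dim_row B"
  shows "submatrix (A * B) I J = submatrix A I UNIV * submatrix B UNIV J"
proof (rule eq_matI, goal_cases)
  case (1 i j)
  then have i: "i < card {i. i < dim_row A \<and> i \<in> I}" and j: "j < card {j. j < dim_col B \<and> j \<in> J}"
    by (simp_all add: dim_submatrix)
  have "submatrix (A * B) I J $$ (i, j) = (A * B) $$ (pick I i, pick J j)"
    by (rule submatrix_index) (use i j in auto)
  also have "\<dots> = (\<Sum>l<dim_row B. A $$ (pick I i, l) * B $$ (l, pick J j))"
    using pick_le[OF i] pick_le[OF j] assms by (simp add: scalar_prod_def atLeast0LessThan)
  also have "\<dots> = (\<Sum>l<dim_row B. submatrix A I UNIV $$ (i, l) * submatrix B UNIV J $$ (l, j))"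
    by (rule sum.cong) (use i j assms in \<open>auto simp: submatrix_index pick_UNIV\<close>)
  also have "\<dots> = (submatrix A I UNIV * submatrix B UNIV J) $$ (i, j)"
    using 1 assms by (simp add: scalar_prod_def atLeast0LessThan dim_submatrix)
  finally show ?case .
qed (simp_all add: dim_submatrix)

lemma submatrix_rows:
  assumes A: "A \<in> carrier_mat n m" and I: "I \<subseteq> {..<n}"
  shows "submatrix A I UNIV \<in> carrier_mat (card I) m"
    and "i < card I \<Longrightarrow> j < m \<Longrightarrow> submatrix A I UNIV $$ (i, j) = A $$ (pick I i, j)"
proof -
  have "{i. i < dim_row A \<and> i \<in> I} = I" using A I by auto
  then have card: "card {i. i < dim_row A \<and> i \<in> I} = card I"
    "card {j. j < dim_col A \<and> j \<in> UNIV} = m" using A by simp_all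
  show "submatrix A I UNIV \<in> carrier_mat (card I) m"
    by (rule carrier_matI) (simp_all only: dim_submatrix card)
  show "submatrix A I UNIV $$ (i, j) = A $$ (pick I i, j)" if "i < card I" "j < m"
    using submatrix_index[of i A I j UNIV, unfolded card, OF that] by (simp only: pick_UNIV)
qed

lemma submatrix_cols:
  assumes A: "A \<in> carrier_mat n m" and J: "J \<subseteq> {..<m}"
  shows "submatrix A UNIV J \<in> carrier_mat n (card J)"
    and "i < n \<Longrightarrow> j < card J \<Longrightarrow> submatrix A UNIV J $$ (i, j) = A $$ (i, pick J j)"
proof -
  have "{j. j < dim_col A \<and> j \<in> J} = J" using A J by auto
  then have card: "card {j. j < dim_col A \<and> j \<in> J} = card J"
    "card {i. i < dim_row A \<and> i \<in> UNIV} = n" using A by simp_all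
  show "submatrix A UNIV J \<in> carrier_mat n (card J)"
    by (rule carrier_matI) (simp_all only: dim_submatrix card)
  show "submatrix A UNIV J $$ (i, j) = A $$ (i, pick J j)" if "i < n" "j < card J"
    using submatrix_index[of i A UNIV j J, unfolded card, OF that] by (simp only: pick_UNIV)
qed

lemma det_submatrix_mult_mult:
  fixes A N B :: "'a::idom mat"
  assumes A: "A \<in> carrier_mat n k" and N: "N \<in> carrier_mat k k" and B: "B \<in> carrier_mat k m"
    and I: "I \<subseteq> {..<n}" "card I = k" and J: "J \<subseteq> {..<m}" "card J = k"
  shows "det (submatrix (A * N * B) I J)
    = det (submatrix A I UNIV) * det N * det (submatrix B UNIV J)"
proof -
  have AI: "submatrix A I UNIV \<in> carrier_mat k k"
    using submatrix_rows(1)[OF A I(1)] I(2) by simp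
  have BJ: "submatrix B UNIV J \<in> carrier_mat k k"
    using submatrix_cols(1)[OF B J(1)] J(2) by simp
  have NU: "submatrix N UNIV UNIV = N"
    by (rule eq_matI) (auto simp: dim_submatrix submatrix_index pick_UNIV)
  have "submatrix (A * N * B) I J = submatrix (A * N) I UNIV * submatrix B UNIV J"
    by (rule submatrix_mult) (use N B in simp)
  also have "submatrix (A * N) I UNIV = submatrix A I UNIV * submatrix N UNIV UNIV"
    by (rule submatrix_mult) (use A N in simp)
  finally have "submatrix (A * N * B) I J = submatrix A I UNIV * N * submatrix B UNIV J"
    by (simp only: NU)
  then show ?thesis
    using det_mult[OF mult_carrier_mat[OF AI N] BJ] det_mult[OF AI N] by simp
qed

lemma (in vec_space) rank_mult_le_inner_dim:
  assumes A: "A \<in> carrier_mat n k" and B: "B \<in> carrier_mat k nc"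
  shows "rank (A * B) \<le> k"
proof -
  let ?W = "span (set (cols A))"
  let ?X = "span (set (cols (A * B)))"
  have AB: "A * B \<in> carrier_mat n nc" using A B by simp
  have cols_A: "set (cols A) \<subseteq> carrier_vec n" and cols_AB: "set (cols (A * B)) \<subseteq> carrier_vec n"
    using cols_dim[of A] cols_dim[of "A * B"] A by auto
  have "set (cols (A * B)) \<subseteq> ?W"
  proof
    fix x assume "x \<in> set (cols (A * B))"
    then obtain j where j: "j < nc" "x = col (A * B) j"
      using AB by (auto simp: cols_def)
    then have "x = A *\<^sub>v col B j" by (simp only: col_mult2[OF A B])
    moreover have "col B j \<in> carrier_vec k" using B j by auto
    ultimately show "x \<in> ?W"
      using col_space_eq[OF A] A unfolding col_space_def by auto
  qed
  then have XW: "?X \<subseteq> ?W"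
    using span_is_subset span_is_submodule[OF cols_A] by blast
  have W: "subspace class_ring ?W V" and X: "subspace class_ring ?X V"
    using span_is_subspace cols_A cols_AB by auto
  have "vectorspace.dim class_ring (vs ?X) \<le> vectorspace.dim class_ring (vs ?W)"
    using vectorspace.subspace_dim[OF subspace_is_vs[OF W] nested_subspaces[OF W X XW]]
      fin_dim_span_cols[OF A] fin_dim_span_cols[OF AB] by simp
  also have "\<dots> = rank A" by (simp add: rank_def)
  also have "\<dots> \<le> k" by (rule rank_le_nc[OF A])
  finally show ?thesis by (simp add: rank_def)
qed

lemma submatrix_map_mat: "submatrix (map_mat h A) I J = map_mat h (submatrix A I J)"
proof (rule eq_matI, goal_cases)
  case (1 i j)
  then have i: "i < card {i. i < dim_row A \<and> i \<in> I}" and j: "j < card {j. j < dim_col A \<and> j \<in> J}"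
    by (simp_all add: dim_submatrix)
  then show ?case using pick_le[OF i] pick_le[OF j] by (simp add: submatrix_index dim_submatrix)
qed (simp_all add: dim_submatrix)

text \<open>
  Used in both directions: a nonzero minor bounds the rank from below, and a bound on the
  rank makes all minors of larger order vanish.
\<close>

lemma order_le_fract_rank_if_minor_nonzero:
  fixes M :: "'a::idom mat"
  assumes "x \<in> minors M i" "x \<noteq> 0"
  shows "i \<le> fract_rank M"
proof -
  interpret h: inj_comm_ring_hom "to_fract :: 'a \<Rightarrow> 'a fract"
    by unfold_locales auto
  from assms obtain I J where IJ: "x = det (submatrix M I J)" "J \<subseteq> {..<dim_col M}" "card J = i"
    unfolding minors_def by blast
  have "det (submatrix (map_mat to_fract M) I J) \<noteq> 0"
    using assms(2) IJ(1) by (simp add: submatrix_map_mat)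
  then have "card {j. j < dim_col M \<and> j \<in> J}
      \<le> vec_space.rank (dim_row M) (map_mat to_fract M)"
    by (intro vec_space.rank_gt_minor) auto
  moreover have "{j. j < dim_col M \<and> j \<in> J} = J" using IJ(2) by auto
  ultimately show ?thesis using IJ(3) by (simp add: fract_rank_def)
qed

lemma fract_rank_mult_le_inner_dim:
  fixes A B :: "'a::idom mat"
  assumes "A \<in> carrier_mat n k" "B \<in> carrier_mat k m"
  shows "fract_rank (A * B) \<le> k"
proof -
  interpret h: inj_comm_ring_hom "to_fract :: 'a \<Rightarrow> 'a fract"
    by unfold_locales auto
  have "map_mat to_fract (A * B) = map_mat to_fract A * map_mat to_fract B"
    using assms by (rule h.mat_hom_mult)
  then show ?thesis
    using vec_space.rank_mult_le_inner_dim[of "map_mat to_fract A" n k "map_mat to_fract B" m] assms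
    by (simp add: fract_rank_def)
qed

text \<open>
  A minor of order \<open>k\<close> that divides all the others is a greatest common divisor of them, and
  greatest common divisors are unique up to divisibility in both directions.
\<close>

lemma is_last_nonzero_det_divisor_iff:
  fixes M :: "'a::idom mat"
  assumes nz: "\<rho> \<noteq> 0" and mem: "\<rho> \<in> minors M k" and dvd: "\<And>x. x \<in> minors M k \<Longrightarrow> \<rho> dvd x"
    and vanish: "\<And>i x. i > k \<Longrightarrow> x \<in> minors M i \<Longrightarrow> x = 0"
  shows "is_last_nonzero_det_divisor M r \<gamma> \<longleftrightarrow> r = k \<and> \<gamma> dvd \<rho> \<and> \<rho> dvd \<gamma>"
proof
  assume L: "is_last_nonzero_det_divisor M r \<gamma>"
  have "\<not> r < k"
  proof
    assume "r < k"
    with L have "0 dvd \<rho>" using mem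
      unfolding is_last_nonzero_det_divisor_def is_det_divisor_def is_gcd_of_def by blast
    with nz show False by simp
  qed
  moreover have "\<not> r > k"
  proof
    assume "r > k"
    then have "\<forall>x\<in>minors M r. 0 dvd x" using vanish by simp
    then have "0 dvd \<gamma>" using L
      unfolding is_last_nonzero_det_divisor_def is_det_divisor_def is_gcd_of_def by blast
    with L show False by (simp add: is_last_nonzero_det_divisor_def)
  qed
  ultimately have r: "r = k" by simp
  with L have "is_gcd_of (minors M k) \<gamma>"
    by (simp add: is_last_nonzero_det_divisor_def is_det_divisor_def)
  then have "\<gamma> dvd \<rho>" "\<rho> dvd \<gamma>" using mem dvd by (simp_all add: is_gcd_of_def)
  with r show "r = k \<and> \<gamma> dvd \<rho> \<and> \<rho> dvd \<gamma>" by simp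
next
  assume R: "r = k \<and> \<gamma> dvd \<rho> \<and> \<rho> dvd \<gamma>"
  then show "is_last_nonzero_det_divisor M r \<gamma>"
    using nz mem dvd vanish
    by (auto simp: is_last_nonzero_det_divisor_def is_det_divisor_def is_gcd_of_def intro: dvd_trans)
qed

section \<open>The last non-zero determinantal divisor\<close>

text \<open>
  Multiplication by \<open>z F\<close> on \<open>R[t]/(z G)\<close> is reduction modulo \<open>G\<close>, followed by
  multiplication by \<open>F\<close> on \<open>R[t]/(G)\<close>, followed by multiplication by \<open>z\<close>.
\<close>

lemma poly_mat_companion_factor:
  fixes z F G :: "'a::idom poly"
  assumes z: "lead_coeff z = 1" and G: "lead_coeff G = 1"
    and k: "degree G = k" and n: "degree (z * G) = n"
  shows "poly_mat (z * F) (companion_mat (z * G))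
    = row_mat n k (\<lambda>i. pseudo_mod (monom 1 (n - 1 - i)) G) * poly_mat F (companion_mat G)
      * row_mat k n (\<lambda>i. z * monom 1 (k - 1 - i))"
proof -
  have zG: "lead_coeff (z * G) = 1" using z G by (simp add: lead_coeff_mult)
  have z0: "z \<noteq> 0" and G0: "G \<noteq> 0" using z G by auto
  have deg: "n = degree z + k" using degree_mult_eq[OF z0 G0] k n by simp
  let ?P = "\<lambda>i. pseudo_mod (monom 1 (n - 1 - i)) G"
  let ?Q = "\<lambda>i. pseudo_mod (F * ?P i) G"
  have Q: "degree_lt k (?Q i)" for i
    using degree_lt_pseudo_mod[OF G0] k by simp
  have "row_mat n k ?P * poly_mat F (companion_mat G) = row_mat n k ?Q"
    unfolding k[symmetric]
    by (rule row_mat_mult_poly_mat_companion[OF G])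
      (rule degree_lt_pseudo_mod[OF G0] monic_dvd_diff_pseudo_mod[OF G])+
  moreover have "row_mat n k ?Q * row_mat k n (\<lambda>i. z * monom 1 (k - 1 - i))
      = row_mat n n (\<lambda>i. z * ?Q i)"
    by (rule row_mat_mult_shifts) (rule Q)
  moreover have "poly_mat (z * F) (companion_mat (z * G)) = row_mat n n (\<lambda>i. z * ?Q i)"
    unfolding n[symmetric]
  proof (rule poly_mat_companion_eq_row_mat[OF zG], unfold n)
    fix i
    show "degree_lt n (z * ?Q i)" using degree_lt_mult[OF Q, of z] deg by simp
    have "G dvd F * (monom 1 (n - 1 - i) - ?P i) + (F * ?P i - ?Q i)"
      using monic_dvd_diff_pseudo_mod[OF G] by (intro dvd_add dvd_mult)
    then have "z * G dvd z * (F * (monom 1 (n - 1 - i) - ?P i) + (F * ?P i - ?Q i))"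
      by (rule mult_dvd_mono[OF dvd_refl])
    then show "z * G dvd z * F * monom 1 (n - 1 - i) - z * ?Q i"
      by (simp add: algebra_simps)
  qed
  ultimately show ?thesis by simp
qed

lemma pick_atLeastLessThan: "i < n - m \<Longrightarrow> pick {m..<n} i = m + i"
proof -
  assume "i < n - m"
  then have "m + i \<in> {m..<n}" "{a \<in> {m..<n}. a < m + i} = {m..<m + i}" by auto
  then show ?thesis using pick_card_in_set[of "m + i" "{m..<n}"] by simp
qed

text \<open>
  The last \<open>k\<close> rows belong to \<open>t\<^sup>k\<^sup>-\<^sup>1, \<dots>, 1\<close>, which are already reduced modulo \<open>G\<close>.
\<close>

lemma submatrix_remainders_eq_one:
  fixes G :: "'a::idom poly"
  assumes k: "degree G = k" "k \<le> n" and G: "lead_coeff G = 1"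
  shows "submatrix (row_mat n k (\<lambda>i. pseudo_mod (monom 1 (n - 1 - i)) G)) {n - k..<n} UNIV = 1\<^sub>m k"
proof -
  have G0: "G \<noteq> 0" using G by auto
  have red: "pseudo_mod (monom 1 l) G = monom 1 l" if "l < k" for l
  proof -
    have "monom 1 l - pseudo_mod (monom 1 l) G = 0"
    proof (rule dvd_degree_lt_imp_0[OF monic_dvd_diff_pseudo_mod[OF G]])
      show "degree_lt (degree G) (monom 1 l - pseudo_mod (monom 1 l) G)"
        using degree_lt_pseudo_mod[OF G0, of "monom 1 l"] that k by (auto simp: coeff_monom)
    qed
    then show ?thesis by simp
  qed
  let ?A = "row_mat n k (\<lambda>i. pseudo_mod (monom 1 (n - 1 - i)) G)"
  have I: "{n - k..<n} \<subseteq> {..<n}" "card {n - k..<n} = k" using k by auto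
  note rows = submatrix_rows[OF row_mat_carrier[of n k "\<lambda>i. pseudo_mod (monom 1 (n - 1 - i)) G"] I(1),
      unfolded I(2)]
  show ?thesis
  proof (rule eq_matI, unfold index_one_mat(2,3))
    fix i j assume ij: "i < k" "j < k"
    then have pick: "pick {n - k..<n} i = n - k + i" using k(2) by (intro pick_atLeastLessThan) auto
    have "submatrix ?A {n - k..<n} UNIV $$ (i, j) = ?A $$ (n - k + i, j)"
      unfolding rows(2)[OF ij] pick ..
    also have "\<dots> = coeff (pseudo_mod (monom 1 (n - 1 - (n - k + i))) G) (k - 1 - j)"
      by (rule row_mat_index) (use ij k(2) in auto)
    also have "n - 1 - (n - k + i) = k - 1 - i" using ij k(2) by auto
    also have "pseudo_mod (monom 1 (k - 1 - i)) G = monom 1 (k - 1 - i)"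
      by (rule red) (use ij in auto)
    finally show "submatrix ?A {n - k..<n} UNIV $$ (i, j) = 1\<^sub>m k $$ (i, j)"
      using ij by (auto simp: coeff_monom)
  qed (use carrier_matD[OF rows(1)] in auto)
qed

text \<open>
  The first \<open>k\<close> columns belong to \<open>t\<^sup>n\<^sup>-\<^sup>1, \<dots>, t\<^sup>n\<^sup>-\<^sup>k\<close>, where the shifts of the monic polynomial \<open>z\<close> have
  their leading terms, in the same order.
\<close>

lemma det_submatrix_shifts_eq_1:
  fixes z :: "'a::idom poly"
  assumes z: "lead_coeff z = 1" and n: "n = degree z + k"
  shows "det (submatrix (row_mat k n (\<lambda>i. z * monom 1 (k - 1 - i))) UNIV {0..<k}) = 1"
    (is "det ?B = 1")
proof -
  have J: "{0..<k} \<subseteq> {..<n}" "card {0..<k} = k" using n by auto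
  note cols = submatrix_cols[OF row_mat_carrier[of k n "\<lambda>i. z * monom 1 (k - 1 - i)"] J(1),
      unfolded J(2)]
  note B = cols(1)
  have index: "?B $$ (i, j) = (if i = j then 1 else 0)" if "j \<le> i" "i < k" for i j
  proof -
    have "pick {0..<k} j = j" using pick_atLeastLessThan[of j k 0] that by simp
    then have "?B $$ (i, j) = coeff (z * monom 1 (k - 1 - i)) (n - 1 - j)"
      using that n cols(2)[of i j] by simp
    also have "\<dots> = (if i = j then 1 else 0)" by (rule coeff_monic_shift[OF z n that])
    finally show ?thesis .
  qed
  show ?thesis by (rule det_upper_unitriangular[OF B index])
qed

lemma minors_poly_mat_companion:
  fixes z F G :: "'a::idom poly"
  assumes z: "lead_coeff z = 1" and G: "lead_coeff G = 1"
  defines "M \<equiv> poly_mat (z * F) (companion_mat (z * G))"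
    and "\<rho> \<equiv> det (poly_mat F (companion_mat G))"
  shows "\<rho> \<in> minors M (degree G)"
    and "x \<in> minors M (degree G) \<Longrightarrow> \<rho> dvd x"
    and "fract_rank M \<le> degree G"
proof -
  define k n where kn: "k = degree G" "n = degree (z * G)"
  have "z \<noteq> 0" "G \<noteq> 0" using z G by auto
  then have n: "n = degree z + k" by (simp add: kn degree_mult_eq)
  let ?A = "row_mat n k (\<lambda>i. pseudo_mod (monom 1 (n - 1 - i)) G)"
  let ?B = "row_mat k n (\<lambda>i. z * monom 1 (k - 1 - i))"
  let ?N = "poly_mat F (companion_mat G)"
  have N: "?N \<in> carrier_mat k k" unfolding kn by (rule poly_mat_companion_carrier)
  have M: "M = ?A * ?N * ?B"
    unfolding M_def by (rule poly_mat_companion_factor[OF z G]) (simp_all add: kn)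
  have dim_M: "dim_row M = n" "dim_col M = n" unfolding M by simp_all
  have minor: "det (submatrix M I J) = det (submatrix ?A I UNIV) * \<rho> * det (submatrix ?B UNIV J)"
    if "I \<subseteq> {..<n}" "card I = k" "J \<subseteq> {..<n}" "card J = k" for I J
    unfolding M \<rho>_def by (rule det_submatrix_mult_mult[OF _ N]) (use that in auto)
  have "det (submatrix M {n - k..<n} {0..<k}) = \<rho>"
    using n submatrix_remainders_eq_one[of G k n] det_submatrix_shifts_eq_1[OF z n] G
    by (subst minor) (auto simp: kn)
  moreover have "{n - k..<n} \<subseteq> {..<n}" "{0..<k} \<subseteq> {..<n}" "card {n - k..<n} = k" "card {0..<k} = k"
    using n by auto
  ultimately show "\<rho> \<in> minors M (degree G)"
    unfolding minors_def dim_M kn(1)[symmetric] by blast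
  show "\<rho> dvd x" if "x \<in> minors M (degree G)"
    using that minor unfolding minors_def dim_M kn(1)[symmetric] by auto
  have "?A * ?N \<in> carrier_mat n k" by (rule mult_carrier_mat[OF row_mat_carrier N])
  then show "fract_rank M \<le> degree G"
    unfolding M kn(1)[symmetric] by (rule fract_rank_mult_le_inner_dim[OF _ row_mat_carrier])
qed

lemma inj_comm_ring_hom_to_fract_closure:
  "inj_comm_ring_hom (to_fract_closure :: 'a::idom \<Rightarrow> 'a fract alg_closure)"
  by unfold_locales (auto simp: to_fract_closure_def)

lemma root_resultant_eq_det:
  fixes F G :: "'a::idom poly"
  assumes G: "lead_coeff G = 1"
  shows "root_resultant F G = to_fract_closure (det (poly_mat F (companion_mat G)))"
proof -
  interpret inj_comm_ring_hom "to_fract_closure :: 'a \<Rightarrow> 'a fract alg_closure"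
    by (rule inj_comm_ring_hom_to_fract_closure)
  interpret P: map_poly_inj_comm_ring_hom "to_fract_closure :: 'a \<Rightarrow> 'a fract alg_closure" ..
  have "lead_coeff (map_poly to_fract_closure G) = 1" using G by simp
  then show ?thesis
    unfolding root_resultant_def
    using det_poly_mat_companion_eq_prod_proots
      det_poly_mat_companion_hom[OF inj_comm_ring_hom_to_fract_closure G] by metis
qed

theorem corollary2:
  fixes f g z F G :: "'a::elementary_divisor_domain poly" and n :: nat
  assumes "lead_coeff g = 1" and "degree g = n"
    and "lead_coeff z = 1" and "is_gcd_of {f, g} z"
    and "f = z * F" and "g = z * G"
  shows "(\<exists>\<gamma>. is_last_nonzero_det_divisor (poly_mat f (companion_mat g))
                (fract_rank (poly_mat f (companion_mat g))) \<gamma>) \<and>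
         (\<forall>r \<gamma>. is_last_nonzero_det_divisor (poly_mat f (companion_mat g)) r \<gamma> \<longrightarrow>
            r = fract_rank (poly_mat f (companion_mat g)) \<and>
            (\<exists>u. u dvd 1 \<and>
              to_fract_closure \<gamma> = to_fract_closure u * root_resultant F G))"
proof -
  let ?M = "poly_mat f (companion_mat g)"
  let ?\<rho> = "det (poly_mat F (companion_mat G))"
  have G: "lead_coeff G = 1" using assms by (simp add: lead_coeff_mult)
  have z0: "z \<noteq> 0" using assms(3) by auto
  have coprime: "w dvd 1" if "w dvd F" "w dvd G" for w
  proof -
    have "z * w dvd f" "z * w dvd g" using that assms(5,6) by (simp_all add: mult_dvd_mono)
    then have "z * w dvd z * 1" using assms(4) by (simp add: is_gcd_of_def)
    with z0 show ?thesis by (simp only: dvd_mult_cancel_left simp_thms)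
  qed
  have nz: "?\<rho> \<noteq> 0" using det_poly_mat_companion_nonzero[OF G coprime] .
  note minors = minors_poly_mat_companion[where F = F, OF assms(3) G, folded assms(5,6)]
  have rank: "fract_rank ?M = degree G"
    using minors(3) order_le_fract_rank_if_minor_nonzero[OF minors(1) nz] by simp
  have vanish: "x = 0" if "i > degree G" "x \<in> minors ?M i" for i x
    using order_le_fract_rank_if_minor_nonzero[OF that(2)] that(1) rank by auto
  note last_iff = is_last_nonzero_det_divisor_iff[OF nz minors(1,2) vanish]
  have "is_last_nonzero_det_divisor ?M (fract_rank ?M) ?\<rho>"
    unfolding rank by (subst last_iff) auto
  moreover have "r = fract_rank ?M \<and>
      (\<exists>u. u dvd 1 \<and> to_fract_closure \<gamma> = to_fract_closure u * root_resultant F G)"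
    if "is_last_nonzero_det_divisor ?M r \<gamma>" for r \<gamma>
  proof -
    from that have r: "r = degree G" and "\<gamma> dvd ?\<rho>" "?\<rho> dvd \<gamma>"
      by (subst (asm) last_iff; simp)+
    then obtain u v where u: "\<gamma> = ?\<rho> * u" and v: "?\<rho> = \<gamma> * v" by (metis dvdE)
    have "?\<rho> * 1 = ?\<rho> * (u * v)" using v unfolding u by (simp only: mult.assoc mult_1_right)
    with nz have "u * v = 1" by (metis mult_left_cancel)
    then have "u dvd 1" by (metis dvd_triv_left)
    interpret inj_comm_ring_hom "to_fract_closure :: 'a \<Rightarrow> 'a fract alg_closure"
      by (rule inj_comm_ring_hom_to_fract_closure)
    have "to_fract_closure \<gamma> = to_fract_closure u * root_resultant F G"
      unfolding root_resultant_eq_det[OF G] u by (simp add: hom_mult mult.commute)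
    with \<open>u dvd 1\<close> r rank show ?thesis by auto
  qed
  ultimately show ?thesis by blast
qed

end
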